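(* Let $M_1,\dots,M_n\in\mathrm{St}_{p,k}$ be such that $A=\frac1n\sum_{i=1}^n M_i$ has full column rank $k$, and let $G=\operatorname{uf}(A)=A(A^\top A)^{-1/2}$ be the orthogonal factor of the polar decomposition of $A$. Then $$\frac1n\sum_{i=1}^n P^{\mathrm{St}}_G(M_i-G)=0,$$ so that $G$ is a (closed-form) solution of the $R$-barycenter fixed-point equation $G=R^{\mathrm{o}}_G\big(\frac1n\sum_{i=1}^n (R^{\mathrm{o}}_G)^{-1}(M_i)\big)$ associated with the orthographic retraction $R^{\mathrm{o}}$ on $\mathrm{St}_{p,k}$, whose inverse is $(R^{\mathrm{o}}_G)^{-1}(V)=P^{\mathrm{St}}_G(V-G)$. *)

theory Defs
  imports "HOL-Analysis.Analysis"
begin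

text \<open>Matrices are real^'k^'p : p rows, k columns.\<close>

definition stiefel :: "(real^'k^'p) set" where
  "stiefel = {M. transpose M ** M = mat 1}"

definition sym_part :: "real^'k^'k \<Rightarrow> real^'k^'k" where
  "sym_part X = (1/2) *\<^sub>R (X + transpose X)"

text \<open>Orthogonal projection onto the tangent space of the Stiefel manifold at G
  (Euclidean metric): P_G(Z) = Z - G sym(G^T Z).\<close>
definition proj_St :: "real^'k^'p \<Rightarrow> real^'k^'p \<Rightarrow> real^'k^'p" where
  "proj_St G Z = Z - G ** sym_part (transpose G ** Z)"

definition pos_def_mat :: "real^'k^'k \<Rightarrow> bool" where
  "pos_def_mat S \<longleftrightarrow> transpose S = S \<and> (\<forall>x. x \<noteq> 0 \<longrightarrow> x \<bullet> (S *v x) > 0)"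

text \<open>Principal square root of a symmetric positive definite matrix.\<close>
definition mat_sqrt :: "real^'k^'k \<Rightarrow> real^'k^'k" where
  "mat_sqrt S = (THE X. pos_def_mat X \<and> X ** X = S)"

text \<open>Orthogonal factor of the polar decomposition: uf(A) = A (A^T A)^(-1/2).\<close>
definition uf :: "real^'k^'p \<Rightarrow> real^'k^'p" where
  "uf A = A ** matrix_inv (mat_sqrt (transpose A ** A))"

end

theory Submission
  imports Defs
begin

text \<open>Let \<open>R = (A\<^sup>T A)\<^sup>1\<^sup>/\<^sup>2\<close> and \<open>G = A R\<^sup>-\<^sup>1\<close>. Then \<open>G\<^sup>T G = I\<close> and \<open>G\<^sup>T A = R\<close>, so
  \<open>G\<^sup>T (A - G) = R - I\<close> is symmetric and the tangent projection gives
  \<open>P\<^sub>G (A - G) = (A - G) - G (R - I) = A - G R = 0\<close>. As \<open>P\<^sub>G\<close> is linear, the average of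
  the \<open>P\<^sub>G (M\<^sub>i - G)\<close> is \<open>P\<^sub>G (A - G)\<close>. The real work is that the positive definite square
  root exists and is unique, for which we prove the spectral theorem for symmetric matrices by
  maximising the Rayleigh quotient on invariant subspaces.\<close>

lemma symmetric_matrix_inner:
  fixes S :: "real^'n^'n"
  assumes "transpose S = S"
  shows "(S *v x) \<bullet> y = x \<bullet> (S *v y)"
  by (metis assms dot_lmul_matrix transpose_matrix_vector)

lemma linear_coeff_zero_if_quadratic_nonpos:
  fixes b c :: real
  assumes "\<And>t. b * t + c * t\<^sup>2 \<le> 0"
  shows "b = 0"
proof (rule ccontr)
  assume "b \<noteq> 0"
  define d where "d = \<bar>c\<bar> + 1"
  have d: "d > 0" "d + c \<ge> 1" unfolding d_def by linarith+
  have "b * (b / d) + c * (b / d)\<^sup>2 = b\<^sup>2 * (d + c) / d\<^sup>2"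
    using d by (simp add: field_simps power2_eq_square)
  also have "\<dots> > 0" using \<open>b \<noteq> 0\<close> d by (simp add: zero_less_mult_iff)
  finally show False using assms[of "b / d"] by simp
qed

lemma rayleigh_maximizer_is_eigenvector:
  fixes S :: "real^'n^'n"
  assumes sym: "transpose S = S" and W: "subspace W" "(*v) S ` W \<subseteq> W"
    and u: "u \<in> W" "norm u = 1"
    and max: "\<And>x. x \<in> W \<Longrightarrow> x \<bullet> (S *v x) \<le> (u \<bullet> (S *v u)) * (x \<bullet> x)"
  shows "S *v u = (u \<bullet> (S *v u)) *\<^sub>R u"
proof -
  define l where "l = u \<bullet> (S *v u)"
  define v where "v = S *v u - l *\<^sub>R u"
  have uu: "u \<bullet> u = 1" using u(2) by (simp add: norm_eq_1)
  have vW: "v \<in> W" unfolding v_def using W u(1)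
    by (meson image_subset_iff subspace_diff subspace_scale)
  have vu: "u \<bullet> v = 0"
    using uu by (simp add: v_def l_def inner_diff_right)
  have vSu: "v \<bullet> (S *v u) = v \<bullet> v"
  proof -
    have "v \<bullet> (S *v u - l *\<^sub>R u) = v \<bullet> (S *v u) - l * (u \<bullet> v)"
      by (simp add: inner_diff_right inner_commute)
    then show ?thesis using vu by (simp add: v_def[symmetric])
  qed
  txt \<open>Expand the maximality of \<open>u\<close> along the line \<open>u + t v\<close>, with \<open>v \<bottom> u\<close>.\<close>
  have "2 * (v \<bullet> v) * t + (v \<bullet> (S *v v) - l * (v \<bullet> v)) * t\<^sup>2 \<le> 0" for t
  proof -
    have "(u + t *\<^sub>R v) \<bullet> (S *v (u + t *\<^sub>R v)) \<le> l * ((u + t *\<^sub>R v) \<bullet> (u + t *\<^sub>R v))"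
      using max[of "u + t *\<^sub>R v"] W(1) u(1) vW unfolding l_def
      by (simp add: subspace_add subspace_scale)
    moreover have "u \<bullet> (S *v v) = v \<bullet> (S *v u)"
      using symmetric_matrix_inner[OF sym, of u v] by (simp add: inner_commute)
    ultimately show ?thesis
      using uu vu vSu
      by (simp add: matrix_vector_right_distrib matrix_vector_mult_scaleR inner_add_left
          inner_add_right inner_commute[of v u] l_def power2_eq_square algebra_simps)
  qed
  then have "2 * (v \<bullet> v) = 0" by (rule linear_coeff_zero_if_quadratic_nonpos)
  then show ?thesis unfolding v_def l_def by simp
qed

lemma symmetric_matrix_invariant_subspace_eigenvector:
  fixes S :: "real^'n^'n"
  assumes sym: "transpose S = S" and W: "subspace W" "(*v) S ` W \<subseteq> W" "W \<noteq> {0}"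
  obtains u where "u \<in> W" "norm u = 1" "S *v u = (u \<bullet> (S *v u)) *\<^sub>R u"
proof -
  let ?K = "W \<inter> sphere 0 1"
  obtain w where w: "w \<in> W" "w \<noteq> 0" using W subspace_0 by blast
  then have "w /\<^sub>R norm w \<in> ?K" using W(1) by (simp add: subspace_scale)
  moreover have "compact ?K"
    using closed_Int_compact[OF closed_subspace[OF W(1)] compact_sphere] .
  moreover have "continuous_on ?K (\<lambda>x. x \<bullet> (S *v x))"
    by (intro continuous_intros linear_continuous_on) simp
  ultimately obtain u where u: "u \<in> ?K"
    and umax: "\<And>y. y \<in> ?K \<Longrightarrow> y \<bullet> (S *v y) \<le> u \<bullet> (S *v u)"
    using continuous_attains_sup[of ?K] by blast
  have "x \<bullet> (S *v x) \<le> (u \<bullet> (S *v u)) * (x \<bullet> x)" if "x \<in> W" for x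
  proof (cases "x = 0")
    case False
    then have "x /\<^sub>R norm x \<in> ?K" using that W(1) by (simp add: subspace_scale)
    then have "(x /\<^sub>R norm x) \<bullet> (S *v (x /\<^sub>R norm x)) \<le> u \<bullet> (S *v u)" by (rule umax)
    moreover have "(x /\<^sub>R norm x) \<bullet> (S *v (x /\<^sub>R norm x)) = (x \<bullet> (S *v x)) / (x \<bullet> x)"
      by (simp add: matrix_vector_mult_scaleR power2_norm_eq_inner[symmetric] power2_eq_square field_simps)
    ultimately show ?thesis using False by (simp add: divide_le_eq mult.commute)
  qed simp
  with u show ?thesis
    using that rayleigh_maximizer_is_eigenvector[OF sym W(1,2)] by auto
qed

lemma symmetric_matrix_invariant_subspace_eigenbasis:
  fixes S :: "real^'n^'n"
  assumes sym: "transpose S = S"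
  shows "subspace W \<Longrightarrow> (*v) S ` W \<subseteq> W \<Longrightarrow> \<exists>B. finite B \<and> B \<subseteq> W \<and> pairwise orthogonal B
    \<and> (\<forall>b\<in>B. norm b = 1 \<and> (\<exists>\<mu>. S *v b = \<mu> *\<^sub>R b)) \<and> span B = W"
proof (induction "dim W" arbitrary: W rule: less_induct)
  case less
  show ?case
  proof (cases "W = {0}")
    case True
    then show ?thesis by (intro exI[of _ "{}"]) auto
  next
    case False
    obtain u where uW: "u \<in> W" and u1: "norm u = 1" and Su: "S *v u = (u \<bullet> (S *v u)) *\<^sub>R u"
      using symmetric_matrix_invariant_subspace_eigenvector[OF sym less.prems False] by blast
    have uu: "u \<bullet> u = 1" using u1 by (simp add: norm_eq_1)
    define W' where "W' = W \<inter> {x. x \<bullet> u = 0}"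
    have sW': "subspace W'"
      unfolding W'_def by (intro subspace_inter less.prems(1) subspace_hyperplane2)
    have iW': "(*v) S ` W' \<subseteq> W'"
    proof clarify
      fix x assume x: "x \<in> W'"
      have "(S *v x) \<bullet> u = (u \<bullet> (S *v u)) * (x \<bullet> u)"
        by (metis Su symmetric_matrix_inner[OF sym] inner_scaleR_right)
      then show "S *v x \<in> W'" using x less.prems(2) unfolding W'_def by auto
    qed
    have "u \<notin> W'" using uu by (simp add: W'_def)
    then have "W' \<subset> W" using uW unfolding W'_def by blast
    then have "dim W' < dim W"
      by (metis dim_psubset less.prems(1) sW' span_eq_iff)
    from less.hyps[OF this sW' iW'] obtain B' where B': "finite B'" "B' \<subseteq> W'" "pairwise orthogonal B'"
      "\<forall>b\<in>B'. norm b = 1 \<and> (\<exists>\<mu>. S *v b = \<mu> *\<^sub>R b)" "span B' = W'" by blast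
    have "W \<subseteq> span (insert u B')"
    proof
      fix x assume "x \<in> W"
      then have "x - (x \<bullet> u) *\<^sub>R u \<in> W'" unfolding W'_def using uW uu less.prems(1)
        by (simp add: subspace_diff subspace_scale inner_diff_left)
      then show "x \<in> span (insert u B')" using B'(5) span_breakdown_eq by blast
    qed
    moreover have "span (insert u B') \<subseteq> W"
      using B'(2) uW less.prems(1) unfolding W'_def by (simp add: span_minimal)
    moreover have "pairwise orthogonal (insert u B')"
      using B'(2,3) unfolding pairwise_insert W'_def orthogonal_def by (auto simp: inner_commute)
    ultimately show ?thesis
      using B' uW u1 Su by (intro exI[of _ "insert u B'"]) (auto simp: W'_def)
  qed
qed

lemma symmetric_matrix_orthonormal_eigenbasis:
  fixes S :: "real^'n^'n"
  assumes "transpose S = S"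
  obtains B where "finite B" "pairwise orthogonal B" "\<And>b. b \<in> B \<Longrightarrow> norm b = 1"
    "\<And>b. b \<in> B \<Longrightarrow> \<exists>\<mu>. S *v b = \<mu> *\<^sub>R b" "span B = UNIV"
  using symmetric_matrix_invariant_subspace_eigenbasis[OF assms, of UNIV] by auto

lemma orthonormal_inner:
  assumes "pairwise orthogonal B" "\<And>b. b \<in> B \<Longrightarrow> norm b = 1" "b \<in> B" "c \<in> B"
  shows "b \<bullet> c = (if b = c then 1 else 0)"
  using assms by (auto simp: pairwise_def orthogonal_def norm_eq_1)

lemma orthonormal_sum_at_member:
  assumes "finite B" "pairwise orthogonal B" "\<And>b. b \<in> B \<Longrightarrow> norm b = 1" "b \<in> B"
  shows "(\<Sum>c\<in>B. (g c * (b \<bullet> c)) *\<^sub>R c) = g b *\<^sub>R b"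
proof -
  have "(\<Sum>c\<in>B. (g c * (b \<bullet> c)) *\<^sub>R c) = (\<Sum>c\<in>B. if c = b then g b *\<^sub>R c else 0)"
    using orthonormal_inner[OF assms(2,3,4)] by (intro sum.cong) auto
  also have "\<dots> = g b *\<^sub>R b" using assms(1,4) by simp
  finally show ?thesis .
qed

lemma matrix_eq_on_spanning_set:
  fixes X Y :: "real^'n^'m"
  assumes "span B = UNIV" "\<And>b. b \<in> B \<Longrightarrow> X *v b = Y *v b"
  shows "X = Y"
  unfolding matrix_eq
  using real_vector.linear_eq_on_span[OF matrix_vector_mul_linear matrix_vector_mul_linear] assms
  by blast

lemma pos_def_mat_eigenvalue_pos:
  assumes "pos_def_mat S" "S *v b = \<mu> *\<^sub>R b" "b \<noteq> 0"
  shows "\<mu> > 0"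
proof -
  have "0 < b \<bullet> (S *v b)" using assms unfolding pos_def_mat_def by blast
  also have "\<dots> = \<mu> * (b \<bullet> b)" using assms(2) by simp
  moreover have "b \<bullet> b > 0" using assms(3) by simp
  ultimately show ?thesis by (simp add: zero_less_mult_iff)
qed

lemma pos_def_mat_with_orthonormal_eigenbasis:
  fixes B :: "(real^'n) set"
  assumes B: "finite B" "pairwise orthogonal B" "\<And>b. b \<in> B \<Longrightarrow> norm b = 1" "span B = UNIV"
    and g: "\<And>b. b \<in> B \<Longrightarrow> g b > 0"
  obtains R where "pos_def_mat R" "\<And>b. b \<in> B \<Longrightarrow> R *v b = g b *\<^sub>R b"
proof -
  define f where "f x = (\<Sum>b\<in>B. (g b * (x \<bullet> b)) *\<^sub>R b)" for x
  define R where "R = matrix f"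
  have "linear f"
    unfolding f_def by (rule linearI) (simp_all add: inner_add_left algebra_simps sum.distrib scaleR_sum_right)
  then have Rx: "R *v x = f x" for x
    unfolding R_def by (simp add: matrix_works)
  have xRy: "x \<bullet> (R *v y) = (\<Sum>b\<in>B. g b * (y \<bullet> b) * (x \<bullet> b))" for x y
    unfolding Rx f_def by (simp add: inner_sum_right)
  have "transpose R = R"
  proof -
    have "(x v* R) \<bullet> z = (R *v x) \<bullet> z" for x z
    proof -
      have "(x v* R) \<bullet> z = x \<bullet> (R *v z)" by (rule dot_lmul_matrix)
      also have "\<dots> = z \<bullet> (R *v x)" unfolding xRy by (simp only: mult.commute mult.left_commute)
      finally show ?thesis by (simp only: inner_commute)
    qed
    then have "transpose R *v x = R *v x" for x
      using vector_eq_rdot[of "x v* R" "R *v x"] by (simp add: transpose_matrix_vector)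
    then show ?thesis by (simp add: matrix_eq)
  qed
  moreover have "x \<bullet> (R *v x) > 0" if "x \<noteq> 0" for x
  proof -
    have "x = (\<Sum>b\<in>B. (x \<bullet> b) *\<^sub>R b)"
      using orthonormal_basis_expand[OF B(2) _ _ B(1)] B(3,4) by simp
    then obtain b where b: "b \<in> B" "x \<bullet> b \<noteq> 0"
      using \<open>x \<noteq> 0\<close> by (metis (no_types, lifting) scale_eq_0_iff sum.neutral)
    have "0 < (\<Sum>c\<in>B. g c * ((x \<bullet> c) * (x \<bullet> c)))"
    proof (rule sum_pos2[OF B(1) b(1)])
      show "0 < g b * ((x \<bullet> b) * (x \<bullet> b))" using g[OF b(1)] b(2) by (simp add: not_square_less_zero less_le)
      show "0 \<le> g c * ((x \<bullet> c) * (x \<bullet> c))" if "c \<in> B" for c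
        using g[OF that] by (simp add: less_imp_le)
    qed
    then show ?thesis by (simp add: xRy mult.assoc)
  qed
  moreover have "R *v b = g b *\<^sub>R b" if "b \<in> B" for b
    unfolding Rx f_def using orthonormal_sum_at_member[OF B(1-3) that] .
  ultimately show thesis using that unfolding pos_def_mat_def by blast
qed

lemma pos_def_mat_orthonormal_eigenbasis:
  fixes S :: "real^'n^'n"
  assumes "pos_def_mat S"
  obtains B \<mu> where "finite B" "pairwise orthogonal B" "\<And>b. b \<in> B \<Longrightarrow> norm b = 1"
    "span B = UNIV" "\<And>b. b \<in> B \<Longrightarrow> S *v b = \<mu> b *\<^sub>R b" "\<And>b. b \<in> B \<Longrightarrow> \<mu> b > 0"
proof -
  obtain B where B: "finite B" "pairwise orthogonal B" "\<And>b. b \<in> B \<Longrightarrow> norm b = 1"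
    "\<And>b. b \<in> B \<Longrightarrow> \<exists>\<mu>. S *v b = \<mu> *\<^sub>R b" "span B = UNIV"
    using symmetric_matrix_orthonormal_eigenbasis assms unfolding pos_def_mat_def by blast
  then obtain \<mu> where \<mu>: "\<And>b. b \<in> B \<Longrightarrow> S *v b = \<mu> b *\<^sub>R b" by metis
  have "\<mu> b > 0" if "b \<in> B" for b
    using pos_def_mat_eigenvalue_pos[OF assms \<mu>[OF that]] B(3)[OF that] by (metis norm_zero zero_neq_one)
  with B \<mu> that show thesis by blast
qed

lemma pos_def_mat_sqrt_eigenvector:
  assumes "pos_def_mat X" "X ** X = S" "S *v b = \<mu> *\<^sub>R b" "\<mu> \<ge> 0"
  shows "X *v b = sqrt \<mu> *\<^sub>R b"
proof -
  define c where "c = sqrt \<mu>"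
  define w where "w = X *v b - c *\<^sub>R b"
  have "c \<ge> 0" "c * c = \<mu>" using assms(4) by (simp_all add: c_def)
  have "X *v w = S *v b - c *\<^sub>R (X *v b)"
    unfolding w_def using assms(2)
    by (simp add: matrix_vector_mult_diff_distrib matrix_vector_mult_scaleR matrix_vector_mul_assoc)
  also have "\<dots> = - c *\<^sub>R w"
    unfolding w_def assms(3) \<open>c * c = \<mu>\<close>[symmetric] by (simp add: algebra_simps)
  finally have "w \<bullet> (X *v w) = - c * (w \<bullet> w)" by simp
  then have "\<not> w \<bullet> (X *v w) > 0" using \<open>c \<ge> 0\<close> by (simp add: not_less mult_nonneg_nonneg)
  then have "w = 0" using assms(1) unfolding pos_def_mat_def by blast
  then show ?thesis by (simp add: w_def c_def)
qed

lemma pos_def_mat_sqrt_exists: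
  fixes S :: "real^'n^'n"
  assumes "pos_def_mat S"
  shows "\<exists>R. pos_def_mat R \<and> R ** R = S"
proof -
  obtain B \<mu> where B: "finite B" "pairwise orthogonal B" "\<And>b. b \<in> B \<Longrightarrow> norm b = 1" "span B = UNIV"
    and \<mu>: "\<And>b. b \<in> B \<Longrightarrow> S *v b = \<mu> b *\<^sub>R b" "\<And>b. b \<in> B \<Longrightarrow> \<mu> b > 0"
    using pos_def_mat_orthonormal_eigenbasis[OF assms] by blast
  obtain R where R: "pos_def_mat R" "\<And>b. b \<in> B \<Longrightarrow> R *v b = sqrt (\<mu> b) *\<^sub>R b"
    using pos_def_mat_with_orthonormal_eigenbasis[OF B, of "\<lambda>b. sqrt (\<mu> b)"] \<mu>(2) by auto
  have "R ** R = S"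
  proof (rule matrix_eq_on_spanning_set[OF B(4)])
    fix b assume b: "b \<in> B"
    have "(R ** R) *v b = sqrt (\<mu> b) *\<^sub>R sqrt (\<mu> b) *\<^sub>R b"
      by (simp add: matrix_vector_mul_assoc[symmetric] R(2)[OF b] matrix_vector_mult_scaleR)
    also have "\<dots> = S *v b" using \<mu>[OF b] by (simp add: less_imp_le)
    finally show "(R ** R) *v b = S *v b" .
  qed
  with R(1) show ?thesis by blast
qed

lemma pos_def_mat_sqrt_unique:
  fixes S :: "real^'n^'n"
  assumes "pos_def_mat S" "pos_def_mat X" "X ** X = S" "pos_def_mat Y" "Y ** Y = S"
  shows "X = Y"
proof -
  obtain B \<mu> where B: "span B = UNIV"
    and \<mu>: "\<And>b. b \<in> B \<Longrightarrow> S *v b = \<mu> b *\<^sub>R b" "\<And>b. b \<in> B \<Longrightarrow> \<mu> b > 0"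
    using pos_def_mat_orthonormal_eigenbasis[OF assms(1)] by metis
  show ?thesis
    using B pos_def_mat_sqrt_eigenvector[OF assms(2,3) \<mu>(1)] pos_def_mat_sqrt_eigenvector[OF assms(4,5) \<mu>(1)]
      \<mu>(2) by (intro matrix_eq_on_spanning_set) (auto simp: less_imp_le)
qed

lemma mat_sqrt:
  assumes "pos_def_mat S"
  shows "pos_def_mat (mat_sqrt S)" "mat_sqrt S ** mat_sqrt S = S"
proof -
  have "\<exists>!R. pos_def_mat R \<and> R ** R = S"
    using pos_def_mat_sqrt_exists[OF assms] pos_def_mat_sqrt_unique[OF assms] by blast
  then have "pos_def_mat (mat_sqrt S) \<and> mat_sqrt S ** mat_sqrt S = S"
    unfolding mat_sqrt_def by (rule theI')
  then show "pos_def_mat (mat_sqrt S)" "mat_sqrt S ** mat_sqrt S = S" by blast+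
qed

lemma transpose_add: "transpose ((A::'a::semiring_1^'n^'m) + B) = transpose A + transpose B"
  by (simp add: transpose_def vec_eq_iff)

lemma transpose_diff: "transpose ((A::'a::ring_1^'n^'m) - B) = transpose A - transpose B"
  by (simp add: transpose_def vec_eq_iff)

lemma matrix_diff_ldistrib: "(A::'a::ring_1^'n^'m) ** (B - C) = A ** B - A ** C"
  by (simp add: matrix_matrix_mult_def vec_eq_iff sum_subtractf algebra_simps)

lemma matrix_scaleR_right: "(A::real^'n^'m) ** (c *\<^sub>R B) = c *\<^sub>R (A ** B)"
  by (simp add: matrix_scalar_ac scalar_matrix_assoc)

lemma invertible_matrix_inv:
  assumes "invertible A"
  shows "A ** matrix_inv A = mat 1" "matrix_inv A ** A = mat 1"
  using someI_ex[OF assms[unfolded invertible_def]] unfolding matrix_inv_def by blast+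

lemma pos_def_mat_invertible:
  assumes "pos_def_mat R"
  shows "invertible R"
proof -
  have "inj ((*v) R)"
  proof (rule injI)
    fix x y assume "R *v x = R *v y"
    then have "(x - y) \<bullet> (R *v (x - y)) = 0" by (simp add: matrix_vector_mult_diff_distrib)
    then show "x = y" using assms unfolding pos_def_mat_def by (metis eq_iff_diff_eq_0 less_irrefl)
  qed
  then show ?thesis
    using matrix_left_invertible_injective invertible_left_inverse by blast
qed

lemma pos_def_mat_gram:
  fixes A :: "real^'k^'p"
  assumes "rank A = CARD('k)"
  shows "pos_def_mat (transpose A ** A)"
  unfolding pos_def_mat_def
proof (intro conjI allI impI)
  show "transpose (transpose A ** A) = transpose A ** A" by (simp add: matrix_transpose_mul)
  fix x :: "real^'k" assume "x \<noteq> 0"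
  then have "A *v x \<noteq> 0"
    using full_rank_injective[of A] assms by (metis injD matrix_vector_mult_0_right)
  moreover have "x \<bullet> ((transpose A ** A) *v x) = (A *v x) \<bullet> (A *v x)"
    by (simp add: matrix_vector_mul_assoc[symmetric] inner_commute[of x] dot_lmul_matrix)
  ultimately show "x \<bullet> ((transpose A ** A) *v x) > 0" by simp
qed

lemma polar_decomposition:
  fixes A :: "real^'k^'p"
  assumes "rank A = CARD('k)"
  shows "uf A \<in> stiefel" "uf A ** mat_sqrt (transpose A ** A) = A"
    "transpose (uf A) ** A = mat_sqrt (transpose A ** A)"
proof -
  define R where "R = mat_sqrt (transpose A ** A)"
  have "pos_def_mat R" and RR: "R ** R = transpose A ** A"
    using mat_sqrt[OF pos_def_mat_gram[OF assms]] by (simp_all add: R_def)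
  then have tR: "transpose R = R" and Ri: "R ** matrix_inv R = mat 1" "matrix_inv R ** R = mat 1"
    using invertible_matrix_inv[OF pos_def_mat_invertible] unfolding pos_def_mat_def by blast+
  have G: "uf A = A ** matrix_inv R" by (simp add: uf_def R_def)
  show "uf A ** R = A" unfolding G by (simp add: matrix_mul_assoc[symmetric] Ri(2))
  have "transpose (matrix_inv R) ** R = mat 1"
    using Ri(1) tR by (metis matrix_transpose_mul transpose_mat)
  then have "transpose (matrix_inv R) ** (R ** R) = R" by (simp add: matrix_mul_assoc)
  then show GtA: "transpose (uf A) ** A = R"
    unfolding G RR by (simp add: matrix_transpose_mul matrix_mul_assoc)
  have "transpose (uf A) ** uf A = (transpose (uf A) ** A) ** matrix_inv R"
    by (simp add: G matrix_mul_assoc)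
  then show "uf A \<in> stiefel" unfolding stiefel_def GtA Ri(1) by simp
qed

lemma proj_St_symmetric:
  assumes "transpose (transpose G ** Z) = transpose G ** Z"
  shows "proj_St G Z = Z - G ** (transpose G ** Z)"
  using assms by (simp add: proj_St_def sym_part_def scaleR_2[symmetric])

lemma proj_St_polar_factor:
  fixes A :: "real^'k^'p"
  assumes "rank A = CARD('k)"
  shows "proj_St (uf A) (A - uf A) = 0"
proof -
  let ?G = "uf A" and ?R = "mat_sqrt (transpose A ** A)"
  have "transpose ?R = ?R"
    using mat_sqrt(1)[OF pos_def_mat_gram[OF assms]] unfolding pos_def_mat_def by blast
  moreover have "transpose ?G ** (A - ?G) = ?R - mat 1"
    using polar_decomposition[OF assms] by (simp add: matrix_diff_ldistrib stiefel_def)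
  ultimately have "proj_St ?G (A - ?G) = (A - ?G) - ?G ** (?R - mat 1)"
    by (simp add: proj_St_symmetric transpose_diff)
  then show ?thesis
    using polar_decomposition(2)[OF assms] by (simp add: matrix_diff_ldistrib)
qed

lemma linear_proj_St: "linear (proj_St (G::real^'k^'p))"
proof (rule linearI)
  fix X Y :: "real^'k^'p"
  show "proj_St G (X + Y) = proj_St G X + proj_St G Y"
    unfolding proj_St_def sym_part_def
    by (simp add: matrix_add_ldistrib transpose_add scaleR_add_right algebra_simps)
next
  fix c :: real and X :: "real^'k^'p"
  show "proj_St G (c *\<^sub>R X) = c *\<^sub>R proj_St G X"
    unfolding proj_St_def sym_part_def
    by (simp add: matrix_scaleR_right transpose_scalar scaleR_add_right[symmetric] scaleR_diff_right)
qed

theorem mainTheorem3: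
  fixes M :: "nat \<Rightarrow> real^'k^'p" and n :: nat
  assumes "n \<ge> 1"
    and "\<forall>i\<in>{1..n}. M i \<in> stiefel"
    and "rank ((1 / real n) *\<^sub>R (\<Sum>i=1..n. M i)) = CARD('k)"
  shows "(1 / real n) *\<^sub>R (\<Sum>i=1..n. proj_St (uf ((1 / real n) *\<^sub>R (\<Sum>i=1..n. M i))) (M i - uf ((1 / real n) *\<^sub>R (\<Sum>i=1..n. M i)))) = 0"
proof -
  define A where "A = (1 / real n) *\<^sub>R (\<Sum>i=1..n. M i)"
  define G where "G = uf A"
  have "(\<Sum>i=1..n. proj_St G (M i - G)) = proj_St G (\<Sum>i=1..n. M i - G)"
    by (rule real_vector.linear_sum[OF linear_proj_St, symmetric])
  also have "(\<Sum>i=1..n. M i - G) = real n *\<^sub>R (A - G)"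
    using assms(1) by (simp add: A_def sum_subtractf scaleR_diff_right sum_constant_scaleR del: sum_constant)
  also have "proj_St G (real n *\<^sub>R (A - G)) = real n *\<^sub>R proj_St G (A - G)"
    by (rule real_vector.linear_scale[OF linear_proj_St])
  also have "proj_St G (A - G) = 0"
    unfolding G_def using proj_St_polar_factor assms(3) A_def by blast
  finally show ?thesis unfolding G_def A_def by simp
qed

end
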